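(* Let $G=(V,E_G,w_G)$ be a connected weighted graph and $H=(V,E_H,w_H)$ a weighted graph on the same vertex set $V$, with positive edge weights. Let $d\in\mathbb{R}^V$ be the vector of (weighted) degrees of $G$, $d_u=vol_G(u)=\sum_{v:(u,v)\in E_G} w_G(u,v)$. Then for every vector $x\in\mathbb{R}^V$ with $x^T d=0$ and $x^T L_H x>0$, $$\frac{x^T L_G x}{x^T L_H x}\;\geq\; \frac{\phi(G,D_G)\,\phi(G,H)}{4},$$ where $D_G$ is the demand graph of $G$.
   Context: For a weighted graph $G$ on $V$, $L_G$ is its Laplacian: $L_G(u,v)=-w_G(u,v)$ for $u\neq v$ and $L_G(u,u)=\sum_{v\neq u} w_G(u,v)$, so $x^TL_Gx=\sum_{uv\in E_G} w_G(u,v)(x_u-x_v)^2$. For $S\subseteq V$, $\bar S=V\setminus S$ and $cap_G(S,\bar S)$ is the total weight of edges of $G$ with exactly one endpoint in $S$. For two graphs $G,H$ on the same vertex set, the generalized conductance is $\phi(G,H)=\min_{S\subseteq V} \frac{cap_G(S,\bar S)}{cap_H(S,\bar S)}$, the minimum taken over subsets $S$ with $cap_H(S,\bar S)>0$. With $vol(V)=\sum_{u\in V} vol_G(u)$, the demand graph $D_G$ of $G$ is the complete graph on $V$ in which each pair $u\neq v$ is joined by an edge of weight $\frac{vol_G(u)\,vol_G(v)}{vol(V)}$. *)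

theory Defs
  imports "HOL-Analysis.Analysis" "Graph_Theory.Pair_Digraph" "Graph_Theory.Digraph_Component"
begin

text \<open>The common vertex set is a finite type, so that \<open>real ^ 'v\<close> is the space of vectors indexed
  by vertices. An undirected edge is a pair of opposite arcs of the underlying symmetric digraph.\<close>

record 'v wgraph =
  underlying :: "'v pair_pre_digraph"
  weight :: "'v \<Rightarrow> 'v \<Rightarrow> real"

abbreviation edges :: "'v wgraph \<Rightarrow> ('v \<times> 'v) set" where
  "edges G \<equiv> parcs (underlying G)"

definition weighted_graph :: "('v::finite) wgraph \<Rightarrow> bool" where
  "weighted_graph G \<longleftrightarrow>
     pair_graph (underlying G) \<and> pverts (underlying G) = UNIV \<and>
     (\<forall>(u, v) \<in> edges G. weight G u v > 0 \<and> weight G u v = weight G v u)"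

text \<open>The qualified name avoids the topological notion of the same name.\<close>

definition connected_wgraph :: "('v::finite) wgraph \<Rightarrow> bool" where
  "connected_wgraph G \<longleftrightarrow> Digraph_Component.connected (with_proj (underlying G))"

text \<open>The field \<open>weight\<close> carries no information on pairs that are not edges; here these get
  weight \<open>0\<close>.\<close>

definition edge_weight :: "('v::finite) wgraph \<Rightarrow> 'v \<Rightarrow> 'v \<Rightarrow> real" where
  "edge_weight G u v = (if (u, v) \<in> edges G then weight G u v else 0)"

definition vol :: "('v::finite) wgraph \<Rightarrow> 'v \<Rightarrow> real" where
  "vol G u = (\<Sum>v | (u, v) \<in> edges G. weight G u v)"

definition degree_vec :: "('v::finite) wgraph \<Rightarrow> real ^ 'v" where
  "degree_vec G = (\<chi> u. vol G u)"

definition laplacian :: "('v::finite) wgraph \<Rightarrow> real ^ 'v ^ 'v" where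
  "laplacian G =
     (\<chi> u v. if u = v then (\<Sum>t \<in> UNIV - {u}. edge_weight G u t) else - edge_weight G u v)"

text \<open>Each undirected edge across the cut is counted once, by its arc leaving \<open>S\<close>.\<close>

definition cut_weight :: "('v::finite) wgraph \<Rightarrow> 'v set \<Rightarrow> real" where
  "cut_weight G S = (\<Sum>(u, v) | (u, v) \<in> edges G \<and> u \<in> S \<and> v \<notin> S. weight G u v)"

text \<open>If no cut of \<open>H\<close> has positive weight, the set below is empty and the value is
  unspecified.\<close>

definition gen_conductance :: "('v::finite) wgraph \<Rightarrow> 'v wgraph \<Rightarrow> real" where
  "gen_conductance G H = Min {cut_weight G S / cut_weight H S | S. cut_weight H S > 0}"

definition demand_graph :: "('v::finite) wgraph \<Rightarrow> 'v wgraph" where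
  "demand_graph G =
     \<lparr>underlying = \<lparr>pverts = UNIV, parcs = {(u, v). u \<noteq> v}\<rparr>,
      weight = (\<lambda>u v. vol G u * vol G v / (\<Sum>t\<in>UNIV. vol G t))\<rparr>"

end

theory Submission
  imports Defs
begin

text \<open>
  Let \<open>X\<close> be the value of \<open>x\<close> at a random vertex drawn with probability proportional to
  \<open>vol\<close>, so \<open>X\<close> has mean \<open>0\<close>; put \<open>ssq t = t * \<bar>t\<bar>\<close>, \<open>\<phi> = \<phi>(G, D\<^sub>G)\<close> and
  \<open>\<psi> = \<phi>(G, H)\<close>. Cutting a function at its level sets turns cut inequalities into
  inequalities between total variations. Since \<open>(a - b)\<^sup>2 \<le> 2 * \<bar>ssq a - ssq b\<bar>\<close>, the
  energy in \<open>H\<close> is thus at most \<open>2 / \<psi>\<close> times the total variation of \<open>ssq x\<close> in \<open>G\<close>.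

  To bound the latter by the energy in \<open>G\<close> without losing a factor \<open>2\<close>, no vertex is singled out
  as the centre: with \<open>l(t) = E \<bar>t - X\<bar>\<close> and \<open>L(t) = E (ssq (t - X))\<close>, the arithmetic-geometric
  mean inequality gives on every edge
  \<open>(x\<^sub>u - x\<^sub>v)\<^sup>2 \<ge> \<phi> * \<bar>L(x\<^sub>u) - L(x\<^sub>v)\<bar> - \<phi>\<^sup>2 / 2 * (l(x\<^sub>u)\<^sup>2 + l(x\<^sub>v)\<^sup>2)\<close>.
  By Jensen's inequality \<open>L - ssq / 2\<close> is monotone, so its total variation is
  \<open>TV(L) - TV(ssq) / 2\<close>, and the cut inequality between \<open>G\<close> and \<open>D\<^sub>G\<close> applies to it. In \<open>D\<^sub>G\<close>
  the bound closes because \<open>TV(L) = vol(V) * (E l(X)\<^sup>2 + E X\<^sup>2)\<close> exactly, an identity that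
  follows by symmetrising over triples of vertices, while \<open>TV(ssq) \<le> 2 * vol(V) * E X\<^sup>2\<close>. Here
  total variations are sums over ordered pairs.
\<close>

section \<open>Inequalities for the signed square\<close>

definition ssq :: "real \<Rightarrow> real" where
  "ssq t = t * \<bar>t\<bar>"

text \<open>The difference of the two sides factors according to the signs:
  \<open>(b - a) * (b + 3 * a)\<close> for \<open>0 \<le> a\<close>, \<open>(a + b)\<^sup>2\<close>
  for \<open>a < 0 \<le> b\<close>, and the mirror image of the first for
  \<open>b < 0\<close>.\<close>

lemma square_diff_le_ssq_diff:
  assumes "a \<le> b"
  shows "(a - b)\<^sup>2 \<le> 2 * (ssq b - ssq a)"
proof -
  consider "0 \<le> a" | "a < 0" "0 \<le> b" | "b < 0" by linarith
  then show ?thesis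
  proof cases
    case 1
    then have "0 \<le> (b - a) * (b + 3 * a)" using assms by (intro mult_nonneg_nonneg) auto
    with 1 assms show ?thesis by (simp add: ssq_def power2_eq_square algebra_simps)
  next
    case 2
    have "0 \<le> (a + b)\<^sup>2" by simp
    with 2 show ?thesis by (simp add: ssq_def power2_eq_square algebra_simps)
  next
    case 3
    then have "0 \<le> (b - a) * (- 3 * b - a)" using assms by (intro mult_nonneg_nonneg) auto
    with 3 assms show ?thesis by (simp add: ssq_def power2_eq_square algebra_simps)
  qed
qed

lemma ssq_mono:
  assumes "a \<le> b"
  shows "ssq a \<le> ssq b"
  using order_trans[OF zero_le_power2 square_diff_le_ssq_diff[OF assms]] by simp

lemma square_diff_le_ssq: "(a - b)\<^sup>2 \<le> 2 * \<bar>ssq a - ssq b\<bar>"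
  using square_diff_le_ssq_diff[of a b] square_diff_le_ssq_diff[of b a] ssq_mono[of a b] ssq_mono[of b a]
  by (cases "a \<le> b") (simp_all add: power2_commute)

text \<open>The trapezoid rule overestimates the integral of the convex derivative
  \<open>2 * \<bar>t\<bar>\<close> of \<open>ssq\<close>. In the proof,
  \<open>2 * (ssq a - ssq b)\<close> splits into two products, each bounded by the right-hand
  side.\<close>

lemma ssq_trapezoid: "\<bar>ssq a - ssq b\<bar> \<le> \<bar>a - b\<bar> * (\<bar>a\<bar> + \<bar>b\<bar>)"
proof -
  have "2 * (ssq a - ssq b) = (a - b) * (\<bar>a\<bar> + \<bar>b\<bar>) + (a + b) * (\<bar>a\<bar> - \<bar>b\<bar>)"
    by (simp add: ssq_def algebra_simps)
  moreover have "\<bar>(a + b) * (\<bar>a\<bar> - \<bar>b\<bar>)\<bar> \<le> \<bar>a - b\<bar> * (\<bar>a\<bar> + \<bar>b\<bar>)"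
  proof (cases "0 \<le> a \<longleftrightarrow> 0 \<le> b")
    case True
    then have "\<bar>\<bar>a\<bar> - \<bar>b\<bar>\<bar> = \<bar>a - b\<bar>" "\<bar>a + b\<bar> = \<bar>a\<bar> + \<bar>b\<bar>" by auto
    then show ?thesis by (simp add: abs_mult)
  next
    case False
    then have "\<bar>a - b\<bar> = \<bar>a\<bar> + \<bar>b\<bar>" by auto
    moreover have "\<bar>a + b\<bar> \<le> \<bar>a\<bar> + \<bar>b\<bar>" "\<bar>\<bar>a\<bar> - \<bar>b\<bar>\<bar> \<le> \<bar>a\<bar> + \<bar>b\<bar>" by auto
    ultimately show ?thesis by (simp add: abs_mult mult_mono)
  qed
  moreover have "\<bar>(a - b) * (\<bar>a\<bar> + \<bar>b\<bar>)\<bar> = \<bar>a - b\<bar> * (\<bar>a\<bar> + \<bar>b\<bar>)"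
    by (simp add: abs_mult)
  moreover have "\<bar>s\<bar> \<le> z" if "2 * s = X + Y" "\<bar>Y\<bar> \<le> z" "\<bar>X\<bar> = z" for s X Y z :: real
    using that by linarith
  ultimately show ?thesis by blast
qed

text \<open>Convexity gives \<open>\<bar>t - s\<bar> \<ge> \<bar>t\<bar> - s * sgn t\<close>;
  integrating twice this over \<open>[u, v]\<close> yields the bound. The correction is linear in
  \<open>s\<close>, so it vanishes on averaging over values of \<open>s\<close> with mean 0.\<close>

lemma ssq_diff_convex:
  assumes "u \<le> v"
  shows "ssq v - ssq u - 2 * s * (\<bar>v\<bar> - \<bar>u\<bar>) \<le> ssq (v - s) - ssq (u - s)"
proof -
  have *: "ssq v - ssq u - 2 * s * (\<bar>v\<bar> - \<bar>u\<bar>) \<le> ssq (v - s) - ssq (u - s)"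
    if "u \<le> v" "0 \<le> s" for u v s
  proof -
    \<comment> \<open>This closed form replaces the integral: the remainder depends on
      \<open>t\<close> only through its clamping to \<open>[0, s]\<close>, and is nondecreasing in
      \<open>t\<close>.\<close>
    have r: "ssq (t - s) - ssq t + 2 * s * \<bar>t\<bar> = s\<^sup>2 - 2 * (s - max 0 (min t s))\<^sup>2" for t
    proof -
      consider "t < 0" | "0 \<le> t" "t < s" | "s \<le> t" by linarith
      then show ?thesis
        using that by cases (simp_all add: ssq_def max_def min_def power2_eq_square algebra_simps)
    qed
    have "(s - max 0 (min v s))\<^sup>2 \<le> (s - max 0 (min u s))\<^sup>2"
      using that by (intro power_mono) auto
    then show ?thesis using r[of u] r[of v] by (simp add: algebra_simps)
  qed
  \<comment> \<open>Reflection at 0 swaps the roles of \<open>u\<close> and \<open>v\<close> and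
    turns a negative \<open>s\<close> into a positive one.\<close>
  have odd: "ssq (- t) = - ssq t" for t by (simp add: ssq_def)
  show ?thesis
  proof (cases "0 \<le> s")
    case True
    then show ?thesis using * assms by blast
  next
    case False
    then show ?thesis
      using *[of "- v" "- u" "- s"] assms odd[of "v - s"] odd[of "u - s"]
      by (simp add: odd algebra_simps)
  qed
qed

text \<open>Both sides are symmetric in \<open>a\<close>, \<open>b\<close>, \<open>c\<close>. For
  sorted arguments every absolute value resolves and a polynomial identity remains.\<close>

lemma ssq_triple:
  "2 * (\<bar>ssq (b - a) - ssq (c - a)\<bar> + \<bar>ssq (a - b) - ssq (c - b)\<bar> + \<bar>ssq (a - c) - ssq (b - c)\<bar>)
   = 2 * (\<bar>a - b\<bar> * \<bar>a - c\<bar> + \<bar>b - a\<bar> * \<bar>b - c\<bar> + \<bar>c - a\<bar> * \<bar>c - b\<bar>)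
     + (a - b)\<^sup>2 + (b - c)\<^sup>2 + (a - c)\<^sup>2" (is "?P a b c")
proof -
  have *: "?P a b c" if "a \<le> b" "b \<le> c" for a b c
  proof -
    have "ssq (b - a) \<le> ssq (c - a)" "ssq (a - b) \<le> ssq (c - b)" "ssq (a - c) \<le> ssq (b - c)"
      using that by (auto intro: ssq_mono)
    then show ?thesis
      using that by (simp add: ssq_def power2_eq_square algebra_simps)
  qed
  consider "a \<le> b" "b \<le> c" | "a \<le> c" "c \<le> b" | "b \<le> a" "a \<le> c"
    | "b \<le> c" "c \<le> a" | "c \<le> a" "a \<le> b" | "c \<le> b" "b \<le> a"
    by linarith
  then show ?thesis
    by cases (use *[of a b c] *[of a c b] *[of b a c] *[of b c a] *[of c a b] *[of c b a]
      in \<open>simp_all add: abs_minus_commute power2_commute mult.commute add.commute add.left_commute\<close>)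
qed

section \<open>Comparing total variations through cuts\<close>

definition tv :: "('v::finite \<Rightarrow> 'v \<Rightarrow> real) \<Rightarrow> ('v \<Rightarrow> real) \<Rightarrow> real" where
  "tv W f = (\<Sum>u\<in>UNIV. \<Sum>v\<in>UNIV. W u v * \<bar>f u - f v\<bar>)"

definition cut :: "('v::finite \<Rightarrow> 'v \<Rightarrow> real) \<Rightarrow> 'v set \<Rightarrow> real" where
  "cut W S = (\<Sum>u\<in>S. \<Sum>v\<in>- S. W u v)"

definition energy :: "('v::finite \<Rightarrow> 'v \<Rightarrow> real) \<Rightarrow> ('v \<Rightarrow> real) \<Rightarrow> real" where
  "energy W f = (\<Sum>u\<in>UNIV. \<Sum>v\<in>UNIV. W u v * (f u - f v)\<^sup>2)"

text \<open>Only cuts are constrained, so that \<open>W\<close> may be a difference of two weights.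
  Induction on the number of values of \<open>f\<close>: lowering the top level set \<open>S\<close>
  from \<open>M\<close> to the next value \<open>m\<close> changes only pairs separated by
  \<open>S\<close>, each by \<open>M - m\<close>, and so removes \<open>M - m\<close> times the cuts
  of \<open>S\<close> and \<open>- S\<close>.\<close>

lemma tv_nonneg_of_cuts:
  assumes "\<And>S. 0 \<le> cut W S"
  shows "0 \<le> tv W f"
proof (induction "card (range f)" arbitrary: f rule: less_induct)
  case less
  define M where "M = Max (range f)"
  show ?case
  proof (cases "range f = {M}")
    case True
    then have "f u = M" for u by auto
    then show ?thesis by (simp add: tv_def)
  next
    case False
    have M: "M \<in> range f" "\<And>u. f u \<le> M" unfolding M_def by auto
    define R where "R = range f - {M}"
    have R: "finite R" "R \<noteq> {}" using False M unfolding R_def by auto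
    define m where "m = Max R"
    have m: "m \<in> R" "\<And>r. r \<in> R \<Longrightarrow> r \<le> m" using R unfolding m_def by auto
    have mM: "m < M" using m(1) M(2) unfolding R_def by (metis DiffE imageE insertI1 order_le_less)
    define S where "S = {u. f u = M}"
    define f' where "f' u = min (f u) m" for u
    have notS: "f u \<le> m" if "u \<notin> S" for u using that m(2) unfolding S_def R_def by auto
    have "range f' \<subseteq> R"
    proof
      fix y assume "y \<in> range f'"
      then obtain u where u: "y = f' u" by auto
      show "y \<in> R"
        using notS[of u] m(1) mM unfolding u f'_def
        by (cases "u \<in> S") (auto simp: S_def R_def min_def)
    qed
    then have "card (range f') \<le> card R" using R by (intro card_mono)
    also have "card R < card (range f)"
      unfolding R_def using M by (intro card_Diff1_less) auto
    finally have IH: "0 \<le> tv W f'" by (rule less)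
    have split: "\<bar>f u - f v\<bar> = \<bar>f' u - f' v\<bar>
        + (M - m) * ((if u \<in> S \<and> v \<in> - S then 1 else 0) + (if u \<in> - S \<and> v \<in> S then 1 else 0))" for u v
      using notS[of u] notS[of v] mM
      by (cases "u \<in> S"; cases "v \<in> S") (auto simp: f'_def S_def)
    have "tv W f = tv W f' + (M - m) *
        ((\<Sum>u\<in>UNIV. \<Sum>v\<in>UNIV. W u v * (if u \<in> S \<and> v \<in> - S then 1 else 0))
         + (\<Sum>u\<in>UNIV. \<Sum>v\<in>UNIV. W u v * (if u \<in> - S \<and> v \<in> S then 1 else 0)))"
      unfolding tv_def split
      by (simp only: distrib_left sum.distrib sum_distrib_left mult.left_commute)
    moreover have "(\<Sum>u\<in>UNIV. \<Sum>v\<in>UNIV. W u v * (if u \<in> A \<and> v \<in> B then 1 else 0))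
        = (\<Sum>u\<in>A. \<Sum>v\<in>B. W u v)" for A B
    proof -
      have "(\<Sum>u\<in>UNIV. \<Sum>v\<in>UNIV. W u v * (if u \<in> A \<and> v \<in> B then 1 else 0))
          = (\<Sum>u\<in>UNIV. if u \<in> A then \<Sum>v\<in>UNIV. if v \<in> B then W u v else 0 else 0)"
        by (intro sum.cong refl) (auto intro!: sum.cong)
      also have "\<dots> = (\<Sum>u\<in>A. \<Sum>v\<in>B. W u v)"
        by (simp add: sum.If_cases)
      finally show ?thesis .
    qed
    ultimately have "tv W f = tv W f' + (M - m) * (cut W S + cut W (- S))"
      by (simp only: cut_def double_compl)
    then show ?thesis using IH mM assms[of S] assms[of "- S"] by simp
  qed
qed

text \<open>Cuts and total variation are linear in the weights, so the previous lemma applies to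
  \<open>A - c * B\<close>.\<close>

lemma tv_ge_of_cuts:
  assumes "\<And>S. c * cut B S \<le> cut A S"
  shows "c * tv B f \<le> tv A f"
proof -
  have "0 \<le> tv (\<lambda>u v. A u v - c * B u v) f"
  proof (rule tv_nonneg_of_cuts)
    fix S
    show "0 \<le> cut (\<lambda>u v. A u v - c * B u v) S"
      using assms[of S] by (simp add: cut_def sum_subtractf sum_distrib_left)
  qed
  then show ?thesis
    by (simp add: tv_def sum_subtractf sum_distrib_left left_diff_distrib mult.assoc)
qed

lemma energy_le_tv:
  assumes "\<And>u v. 0 \<le> W u v"
  shows "energy W x \<le> 2 * tv W (\<lambda>u. ssq (x u))"
  unfolding energy_def tv_def sum_distrib_left
proof (intro sum_mono)
  fix u v
  show "W u v * (x u - x v)\<^sup>2 \<le> 2 * (W u v * \<bar>ssq (x u) - ssq (x v)\<bar>)"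
    using mult_left_mono[OF square_diff_le_ssq[of "x u" "x v"] assms[of u v]] by simp
qed

section \<open>Symmetrisation over triples of vertices\<close>

text \<open>The weight \<open>p a * p b * p c\<close> is invariant under renaming the vertices, so
  the three terms of each kind in \<open>ssq_triple\<close> have equal sums.\<close>

lemma triple_sum_identity:
  fixes p x :: "'v::finite \<Rightarrow> real"
  assumes sum1: "(\<Sum>u\<in>UNIV. p u) = 1" and mean0: "(\<Sum>u\<in>UNIV. p u * x u) = 0"
  shows "(\<Sum>a\<in>UNIV. \<Sum>b\<in>UNIV. \<Sum>c\<in>UNIV. p a * p b * p c * \<bar>ssq (x a - x c) - ssq (x b - x c)\<bar>)
    = (\<Sum>a\<in>UNIV. p a * (\<Sum>b\<in>UNIV. p b * \<bar>x a - x b\<bar>)\<^sup>2) + (\<Sum>a\<in>UNIV. p a * (x a)\<^sup>2)"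
proof -
  define S where "S F = (\<Sum>a\<in>UNIV. \<Sum>b\<in>UNIV. \<Sum>c\<in>UNIV. p a * p b * p c * F (x a) (x b) (x c))"
    for F :: "real \<Rightarrow> real \<Rightarrow> real \<Rightarrow> real"
  have swap12: "S (\<lambda>a b c. F b a c) = S F" for F
    unfolding S_def by (subst sum.swap) (simp add: mult_ac)
  have swap23: "S (\<lambda>a b c. F a c b) = S F" for F
    unfolding S_def by (rule sum.cong[OF refl], subst sum.swap) (simp add: mult_ac)
  have add: "S (\<lambda>a b c. F a b c + G a b c) = S F + S G" for F G
    unfolding S_def by (simp add: distrib_left sum.distrib)
  have scale: "S (\<lambda>a b c. k * F a b c) = k * S F" for k F
    unfolding S_def by (simp add: sum_distrib_left mult_ac)
  define F where "F a b c = \<bar>ssq (a - c) - ssq (b - c)\<bar>" for a b c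
  define H where "H a b c = \<bar>a - b\<bar> * \<bar>a - c\<bar>" for a b c :: real
  define D where "D a b c = (a - b)\<^sup>2" for a b c :: real
  have "2 * (F b c a + (F a c b + F a b c))
      = 2 * (H a b c + (H b a c + H c a b)) + (D a b c + (D b c a + D a c b))" for a b c
    using ssq_triple[of b a c] by (simp add: F_def H_def D_def)
  then have "S (\<lambda>a b c. 2 * (F b c a + (F a c b + F a b c)))
      = S (\<lambda>a b c. 2 * (H a b c + (H b a c + H c a b)) + (D a b c + (D b c a + D a c b)))"
    by simp
  \<comment> \<open>The two swaps of neighbouring arguments generate all permutations, so each
    bracket becomes three copies of one sum.\<close>
  then have "2 * (S F + (S F + S F)) = 2 * (S H + (S H + S H)) + (S D + (S D + S D))"
    using swap12[of F] swap23[of F] swap12[of H] swap23[of H] swap12[of D] swap23[of D]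
      swap12[of "\<lambda>a b c. F a c b"] swap23[of "\<lambda>a b c. F b a c"]
      swap12[of "\<lambda>a b c. H a c b"] swap23[of "\<lambda>a b c. H b a c"]
      swap12[of "\<lambda>a b c. D a c b"] swap23[of "\<lambda>a b c. D b a c"]
    by (simp only: add scale)
  then have "2 * S F = 2 * S H + S D" by simp
  moreover have "S H = (\<Sum>a\<in>UNIV. p a * (\<Sum>b\<in>UNIV. p b * \<bar>x a - x b\<bar>)\<^sup>2)"
    unfolding S_def H_def power2_eq_square sum_product
    by (simp add: sum_distrib_left mult_ac)
  \<comment> \<open>This is twice a variance: the third index sums to 1, and the cross term is the
    square of the mean.\<close>
  moreover have "S D = 2 * (\<Sum>a\<in>UNIV. p a * (x a)\<^sup>2)"
  proof -
    have "S D = (\<Sum>a\<in>UNIV. \<Sum>b\<in>UNIV. p a * p b * (x a - x b)\<^sup>2)"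
      unfolding S_def D_def using sum1
      by (simp add: mult_ac flip: sum_distrib_left sum_distrib_right)
    also have "\<dots> = (\<Sum>a\<in>UNIV. \<Sum>b\<in>UNIV. (p a * (x a)\<^sup>2) * p b)
        + (\<Sum>a\<in>UNIV. \<Sum>b\<in>UNIV. p a * (p b * (x b)\<^sup>2))
        - 2 * (\<Sum>a\<in>UNIV. \<Sum>b\<in>UNIV. (p a * x a) * (p b * x b))"
      by (simp add: power2_diff algebra_simps sum.distrib sum_subtractf sum_distrib_left)
    also have "\<dots> = 2 * (\<Sum>a\<in>UNIV. p a * (x a)\<^sup>2)"
      using sum1 mean0 by (simp flip: sum_distrib_left sum_distrib_right)
    finally show ?thesis .
  qed
  ultimately show ?thesis unfolding S_def F_def by simp
qed

section \<open>The Cheeger-type inequality for weight functions\<close>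

text \<open>The 4 arises as 2 * 2: \<open>\<phi> / 2\<close> times the total variation of
  \<open>ssq x\<close> in \<open>A\<close> is at most the energy in \<open>A\<close>, and twice that
  variation is at least \<open>\<psi>\<close> times the energy in \<open>B\<close>. The product
  weight keeps its diagonal so that double sums factor.\<close>

lemma generalized_cheeger:
  fixes A B :: "'v::finite \<Rightarrow> 'v \<Rightarrow> real" and p x :: "'v \<Rightarrow> real"
  assumes A_sym: "\<And>u v. A u v = A v u" and A_nonneg: "\<And>u v. 0 \<le> A u v"
    and B_nonneg: "\<And>u v. 0 \<le> B u v"
    and V: "0 < V" and deg: "\<And>u. (\<Sum>v\<in>UNIV. A u v) = V * p u"
    and sum1: "(\<Sum>u\<in>UNIV. p u) = 1" and mean0: "(\<Sum>u\<in>UNIV. p u * x u) = 0"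
    and \<phi>: "0 \<le> \<phi>" "\<And>S. \<phi> * cut (\<lambda>u v. V * (p u * p v)) S \<le> cut A S"
    and \<psi>: "0 \<le> \<psi>" "\<And>S. \<psi> * cut B S \<le> cut A S"
  shows "\<phi> * \<psi> / 4 * energy B x \<le> energy A x"
proof -
  define P where "P u v = V * (p u * p v)" for u v
  define g where "g u = ssq (x u)" for u
  define l where "l u = (\<Sum>w\<in>UNIV. p w * \<bar>x u - x w\<bar>)" for u
  define L where "L u = (\<Sum>w\<in>UNIV. p w * ssq (x u - x w))" for u
  \<comment> \<open>The coefficient 1/2 is tuned to the product weight \<open>P\<close>: there half
    the variation of \<open>g\<close> is at most \<open>V * M\<close>, which cancels the
    \<open>M\<close> in \<open>tv P L\<close> and leaves \<open>V * N\<close>.\<close>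
  define f where "f u = L u - g u / 2" for u
  define N where "N = (\<Sum>u\<in>UNIV. p u * (l u)\<^sup>2)"
  define M where "M = (\<Sum>u\<in>UNIV. p u * (x u)\<^sup>2)"
  have p: "0 \<le> p u" for u
    using deg[of u] V sum_nonneg[of UNIV "A u"] A_nonneg
    by (metis zero_le_mult_iff not_le)
  have L_diff: "L u - L v = (\<Sum>w\<in>UNIV. p w * (ssq (x u - x w) - ssq (x v - x w)))" for u v
    by (simp add: L_def right_diff_distrib sum_subtractf)
  \<comment> \<open>Each \<open>ssq (t - x w)\<close> is monotone in \<open>t\<close>, so all
    summands share one sign and the absolute value moves inside.\<close>
  have L_abs: "\<bar>L u - L v\<bar> = (\<Sum>w\<in>UNIV. p w * \<bar>ssq (x u - x w) - ssq (x v - x w)\<bar>)" for u v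
  proof -
    have *: "\<bar>L u - L v\<bar> = (\<Sum>w\<in>UNIV. p w * \<bar>ssq (x u - x w) - ssq (x v - x w)\<bar>)"
      if "x v \<le> x u" for u v
    proof -
      have "ssq (x v - x w) \<le> ssq (x u - x w)" for w using that by (intro ssq_mono) simp
      then show ?thesis
        unfolding L_diff using p by (simp add: sum_nonneg)
    qed
    show ?thesis
      using *[of u v] *[of v u] by (cases "x v \<le> x u") (auto simp: abs_minus_commute)
  qed

  \<comment> \<open>Averaging \<open>ssq_diff_convex\<close> over \<open>s = x w\<close> removes the
    linear term by \<open>mean0\<close>. Hence \<open>L - g\<close>, and all the more
    \<open>f\<close>, is monotone in \<open>x\<close>, and absolute differences subtract.\<close>
  have f_abs: "\<bar>f u - f v\<bar> = \<bar>L u - L v\<bar> - \<bar>g u - g v\<bar> / 2" for u v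
  proof -
    have *: "g v - g u \<le> L v - L u" if "x u \<le> x v" for u v
    proof -
      have "(\<Sum>w\<in>UNIV. p w * (g v - g u - 2 * x w * (\<bar>x v\<bar> - \<bar>x u\<bar>))) \<le> L v - L u"
        unfolding L_diff g_def using p that
        by (intro sum_mono mult_left_mono ssq_diff_convex)
      moreover have "(\<Sum>w\<in>UNIV. p w * (g v - g u - 2 * x w * (\<bar>x v\<bar> - \<bar>x u\<bar>)))
          = (\<Sum>w\<in>UNIV. p w) * (g v - g u) - (\<Sum>w\<in>UNIV. p w * x w) * (2 * (\<bar>x v\<bar> - \<bar>x u\<bar>))"
        by (simp add: right_diff_distrib left_diff_distrib sum_subtractf sum_distrib_left sum_distrib_right mult_ac)
      ultimately show ?thesis using sum1 mean0 by simp
    qed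
    have g: "g u \<le> g v" if "x u \<le> x v" for u v
      using that by (simp add: g_def ssq_mono)
    show ?thesis
      using *[of u v] *[of v u] g[of u v] g[of v u]
      by (cases "x u \<le> x v") (auto simp: f_def field_simps)
  qed
  have tv_f: "tv W f = tv W L - tv W g / 2" for W
    by (simp add: tv_def f_abs right_diff_distrib sum_subtractf sum_divide_distrib)

  have "V * (\<Sum>u\<in>UNIV. \<Sum>v\<in>UNIV. \<Sum>w\<in>UNIV. p u * p v * p w * \<bar>ssq (x u - x w) - ssq (x v - x w)\<bar>) = tv P L"
    by (simp add: tv_def L_abs P_def sum_distrib_left mult_ac)
  then have tv_P_L: "tv P L = V * (N + M)"
    using triple_sum_identity[OF sum1 mean0] by (simp add: N_def M_def l_def)
  have "tv P g \<le> (\<Sum>u\<in>UNIV. \<Sum>v\<in>UNIV. P u v * ((x u)\<^sup>2 + (x v)\<^sup>2))"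
    unfolding tv_def
  proof (intro sum_mono mult_left_mono)
    show "\<bar>g u - g v\<bar> \<le> (x u)\<^sup>2 + (x v)\<^sup>2" for u v
      by (rule order_trans[OF abs_triangle_ineq4]) (simp add: g_def ssq_def abs_mult power2_eq_square)
    show "0 \<le> P u v" for u v using p V by (simp add: P_def)
  qed
  also have "\<dots> = V * ((\<Sum>u\<in>UNIV. \<Sum>v\<in>UNIV. (p u * (x u)\<^sup>2) * p v)
      + (\<Sum>u\<in>UNIV. \<Sum>v\<in>UNIV. p u * (p v * (x v)\<^sup>2)))"
    by (simp add: P_def algebra_simps sum.distrib sum_distrib_left)
  also have "\<dots> = V * (2 * M)"
    using sum1 by (simp add: M_def flip: sum_distrib_left sum_distrib_right)
  finally have "V * N \<le> tv P f" using tv_P_L by (simp add: tv_f algebra_simps)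
  then have "\<phi> * (V * N) \<le> \<phi> * tv P f" using \<phi>(1) by (rule mult_left_mono)
  also have "\<phi> * tv P f \<le> tv A f" using \<phi>(2) by (intro tv_ge_of_cuts) (simp add: P_def[abs_def])
  finally have iso: "\<phi> * (V * N) \<le> tv A L - tv A g / 2" by (simp add: tv_f)

  have edge: "\<phi> * \<bar>L u - L v\<bar> - \<phi>\<^sup>2 / 2 * ((l u)\<^sup>2 + (l v)\<^sup>2) \<le> (x u - x v)\<^sup>2" for u v
  proof -
    have "\<bar>L u - L v\<bar> \<le> (\<Sum>w\<in>UNIV. p w * (\<bar>x u - x v\<bar> * (\<bar>x u - x w\<bar> + \<bar>x v - x w\<bar>)))"
      unfolding L_abs
    proof (intro sum_mono mult_left_mono p)
      show "\<bar>ssq (x u - x w) - ssq (x v - x w)\<bar> \<le> \<bar>x u - x v\<bar> * (\<bar>x u - x w\<bar> + \<bar>x v - x w\<bar>)" for w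
        using ssq_trapezoid[of "x u - x w" "x v - x w"] by simp
    qed
    also have "\<dots> = \<bar>x u - x v\<bar> * (l u + l v)"
      by (simp add: l_def distrib_left sum.distrib sum_distrib_left mult_ac)
    finally have "\<phi> * \<bar>L u - L v\<bar> \<le> \<phi> * (\<bar>x u - x v\<bar> * (l u + l v))"
      using \<phi>(1) by (rule mult_left_mono)
    \<comment> \<open>The first square is the arithmetic-geometric mean inequality; the second turns
      \<open>(l u + l v)\<^sup>2\<close> into
      \<open>2 * ((l u)\<^sup>2 + (l v)\<^sup>2)\<close>.\<close>
    moreover have "0 \<le> (\<bar>x u - x v\<bar> - \<phi> / 2 * (l u + l v))\<^sup>2 + (\<phi> / 2 * (l u - l v))\<^sup>2" by simp
    moreover have "(\<bar>x u - x v\<bar> - \<phi> / 2 * (l u + l v))\<^sup>2 + (\<phi> / 2 * (l u - l v))\<^sup>2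
        = \<bar>x u - x v\<bar>\<^sup>2 - \<phi> * (\<bar>x u - x v\<bar> * (l u + l v)) + \<phi>\<^sup>2 / 2 * ((l u)\<^sup>2 + (l v)\<^sup>2)"
      by (simp add: power2_eq_square field_simps)
    ultimately show ?thesis unfolding power2_abs by linarith
  qed
  have deg': "(\<Sum>u\<in>UNIV. A u v) = V * p v" for v using deg[of v] A_sym by simp
  \<comment> \<open>By \<open>deg\<close> and \<open>deg'\<close> both sums of squares equal
    \<open>V * N\<close>, so the loss is \<open>\<phi>\<close> times the left-hand side of
    \<open>iso\<close>.\<close>
  have "\<phi> * tv A L - \<phi>\<^sup>2 / 2 * ((\<Sum>u\<in>UNIV. \<Sum>v\<in>UNIV. A u v * (l u)\<^sup>2) + (\<Sum>u\<in>UNIV. \<Sum>v\<in>UNIV. A u v * (l v)\<^sup>2))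
      = (\<Sum>u\<in>UNIV. \<Sum>v\<in>UNIV. A u v * (\<phi> * \<bar>L u - L v\<bar> - \<phi>\<^sup>2 / 2 * ((l u)\<^sup>2 + (l v)\<^sup>2)))"
    by (simp add: tv_def algebra_simps sum.distrib sum_subtractf sum_distrib_left sum_divide_distrib)
  also have "\<dots> \<le> energy A x"
    unfolding energy_def using edge A_nonneg by (intro sum_mono mult_left_mono)
  also have "(\<Sum>u\<in>UNIV. \<Sum>v\<in>UNIV. A u v * (l v)\<^sup>2) = (\<Sum>v\<in>UNIV. \<Sum>u\<in>UNIV. A u v * (l v)\<^sup>2)"
    by (rule sum.swap)
  finally have "\<phi> * tv A L - \<phi> * (\<phi> * (V * N)) \<le> energy A x"
    by (simp add: deg deg' N_def power2_eq_square mult_ac flip: sum_distrib_left sum_distrib_right)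
  moreover have "\<phi> * (\<phi> * (V * N)) \<le> \<phi> * (tv A L - tv A g / 2)"
    using iso \<phi>(1) by (rule mult_left_mono)
  moreover have "\<psi> * energy B x \<le> 2 * tv A g"
  proof -
    have "\<psi> * energy B x \<le> \<psi> * (2 * tv B g)"
      using energy_le_tv[of B x] B_nonneg \<psi>(1) by (intro mult_left_mono) (auto simp: g_def[abs_def])
    then show ?thesis using tv_ge_of_cuts[of \<psi> B A g] \<psi>(2) by simp
  qed
  then have "\<phi> * (\<psi> * energy B x) \<le> \<phi> * (2 * tv A g)"
    using \<phi>(1) by (rule mult_left_mono)
  ultimately show ?thesis by (simp add: algebra_simps)
qed

section \<open>From graphs to weight functions\<close>

lemma cut_weight_eq_cut: "cut_weight G S = cut (edge_weight G) S"
proof -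
  have "cut (edge_weight G) S = (\<Sum>(u, v)\<in>S \<times> - S. edge_weight G u v)"
    by (simp add: cut_def sum.cartesian_product)
  also have "\<dots> = (\<Sum>(u, v) | (u, v) \<in> edges G \<and> u \<in> S \<and> v \<notin> S. edge_weight G u v)"
    by (rule sum.mono_neutral_right) (auto simp: edge_weight_def split: if_splits)
  also have "\<dots> = cut_weight G S"
    unfolding cut_weight_def by (rule sum.cong) (auto simp: edge_weight_def)
  finally show ?thesis ..
qed

lemma vol_eq_sum_edge_weight: "vol G u = (\<Sum>v\<in>UNIV. edge_weight G u v)"
  unfolding vol_def edge_weight_def by (simp add: sum.If_cases)

lemma edge_weight_demand_graph:
  "edge_weight (demand_graph G) u v = (if u = v then 0 else vol G u * vol G v / (\<Sum>t\<in>UNIV. vol G t))"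
  by (simp add: edge_weight_def demand_graph_def)

lemma edge_weight_nonneg: "weighted_graph G \<Longrightarrow> 0 \<le> edge_weight G u v"
  by (force simp: weighted_graph_def edge_weight_def)

lemma weighted_graph_arc_sym:
  assumes "weighted_graph G"
  shows "(u, v) \<in> edges G \<longleftrightarrow> (v, u) \<in> edges G"
proof -
  interpret pair_graph "underlying G" using assms by (simp add: weighted_graph_def)
  show ?thesis using arcs_symmetric by blast
qed

lemma edge_weight_sym:
  assumes "weighted_graph G"
  shows "edge_weight G u v = edge_weight G v u"
  using assms weighted_graph_arc_sym[OF assms, of u v]
  by (auto simp: weighted_graph_def edge_weight_def)

text \<open>\<open>energy\<close> meets each undirected edge in both directions, whence the half; it
  cancels in the quotient of the two forms.\<close>

lemma laplacian_quadratic_form: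
  assumes "weighted_graph G"
  shows "x \<bullet> (laplacian G *v x) = energy (edge_weight G) (($) x) / 2"
proof -
  let ?w = "edge_weight G"
  \<comment> \<open>The diagonal sum omits \<open>u\<close>, so it is the full row sum minus
    \<open>?w u u\<close>; one formula then covers all entries.\<close>
  have L: "laplacian G $ u $ v = (if v = u then \<Sum>t\<in>UNIV. ?w u t else 0) - ?w u v" for u v
    by (simp add: laplacian_def sum_diff1)
  have "x \<bullet> (laplacian G *v x) = (\<Sum>u\<in>UNIV. \<Sum>v\<in>UNIV. laplacian G $ u $ v * (x $ u * x $ v))"
    by (simp add: inner_vec_def matrix_vector_mult_def sum_distrib_left mult_ac)
  also have "\<dots> = (\<Sum>u\<in>UNIV. \<Sum>v\<in>UNIV. (if v = u then (\<Sum>t\<in>UNIV. ?w u t) * (x $ u * x $ v) else 0))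
      - (\<Sum>u\<in>UNIV. \<Sum>v\<in>UNIV. ?w u v * (x $ u * x $ v))"
    unfolding L by (simp add: left_diff_distrib sum_subtractf if_distrib[of "\<lambda>a. a * _"] cong: if_cong)
  also have "(\<Sum>u\<in>UNIV. \<Sum>v\<in>UNIV. (if v = u then (\<Sum>t\<in>UNIV. ?w u t) * (x $ u * x $ v) else 0))
      = (\<Sum>u\<in>UNIV. \<Sum>v\<in>UNIV. ?w u v * (x $ u)\<^sup>2)"
    by (simp add: sum_distrib_right power2_eq_square)
  finally have form: "x \<bullet> (laplacian G *v x)
      = (\<Sum>u\<in>UNIV. \<Sum>v\<in>UNIV. ?w u v * (x $ u)\<^sup>2) - (\<Sum>u\<in>UNIV. \<Sum>v\<in>UNIV. ?w u v * (x $ u * x $ v))" .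
  have "(\<Sum>u\<in>UNIV. \<Sum>v\<in>UNIV. ?w u v * (x $ v)\<^sup>2) = (\<Sum>u\<in>UNIV. \<Sum>v\<in>UNIV. ?w u v * (x $ u)\<^sup>2)"
    by (subst sum.swap) (simp add: edge_weight_sym[OF assms])
  moreover have "energy ?w (($) x) = (\<Sum>u\<in>UNIV. \<Sum>v\<in>UNIV. ?w u v * (x $ u)\<^sup>2)
      + (\<Sum>u\<in>UNIV. \<Sum>v\<in>UNIV. ?w u v * (x $ v)\<^sup>2) - 2 * (\<Sum>u\<in>UNIV. \<Sum>v\<in>UNIV. ?w u v * (x $ u * x $ v))"
    by (simp add: energy_def power2_diff algebra_simps sum.distrib sum_subtractf sum_distrib_left)
  ultimately show ?thesis by (simp add: form)
qed

text \<open>The witness \<open>S0\<close> makes the set under \<open>Min\<close> nonempty, so the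
  minimum is attained. For cuts with zero weight in \<open>H\<close> the second bound is just
  nonnegativity in \<open>G\<close>.\<close>

lemma gen_conductance_bounds:
  assumes "\<And>S. 0 \<le> cut_weight G S" and "\<And>S. 0 \<le> cut_weight H S" and "0 < cut_weight H S0"
  shows "0 \<le> gen_conductance G H" "gen_conductance G H * cut_weight H S \<le> cut_weight G S"
proof -
  let ?R = "{cut_weight G S / cut_weight H S | S. cut_weight H S > 0}"
  have "?R = (\<lambda>S. cut_weight G S / cut_weight H S) ` {S. cut_weight H S > 0}" by auto
  then have fin: "finite ?R" by simp
  have "?R \<noteq> {}" using assms(3) by auto
  then have "gen_conductance G H \<in> ?R"
    unfolding gen_conductance_def using fin by (intro Min_in)
  then show "0 \<le> gen_conductance G H" using assms(1,2) by auto
  show "gen_conductance G H * cut_weight H S \<le> cut_weight G S"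
  proof (cases "0 < cut_weight H S")
    case True
    then have "gen_conductance G H \<le> cut_weight G S / cut_weight H S"
      unfolding gen_conductance_def using fin by (intro Min_le) auto
    with True show ?thesis by (simp add: pos_le_divide_eq)
  next
    case False
    then have "cut_weight H S = 0" using assms(2)[of S] by simp
    then show ?thesis using assms(1) by simp
  qed
qed

lemma edge_weight_le_vol: "weighted_graph G \<Longrightarrow> edge_weight G u v \<le> vol G u"
  unfolding vol_eq_sum_edge_weight by (rule member_le_sum) (auto simp: edge_weight_nonneg)

text \<open>A walk between distinct vertices has a first step. Such an arc makes the total volume
  positive.\<close>

lemma connected_wgraph_arc:
  fixes G :: "('v::finite) wgraph" and u v :: 'v
  assumes "weighted_graph G" and "connected_wgraph G" and "u \<noteq> v"
  obtains a b where "(a, b) \<in> edges G"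
proof -
  have "u \<rightarrow>\<^sup>*\<^bsub>mk_symmetric (with_proj (underlying G))\<^esub> v"
    using assms by (auto simp: connected_wgraph_def Digraph_Component.connected_def strongly_connected_def weighted_graph_def)
  then have "edges G \<noteq> {}"
    using \<open>u \<noteq> v\<close>
    by (auto simp: reachable_def mk_symmetric_def elim: converse_rtrancl_on_cases)
  then show ?thesis using that by auto
qed

theorem theorem1:
  fixes G H :: "('v::finite) wgraph" and x :: "real ^ 'v"
  assumes "weighted_graph G" and "connected_wgraph G" and "weighted_graph H"
    and "x \<bullet> degree_vec G = 0"
    and "x \<bullet> (laplacian H *v x) > 0"
  shows "(x \<bullet> (laplacian G *v x)) / (x \<bullet> (laplacian H *v x))
           \<ge> gen_conductance G (demand_graph G) * gen_conductance G H / 4"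
proof -
  define V where "V = (\<Sum>t\<in>UNIV. vol G t)"
  define p where "p u = vol G u / V" for u
  let ?D = "demand_graph G"
  have vol_nonneg: "0 \<le> vol G u" for u
    unfolding vol_eq_sum_edge_weight by (simp add: sum_nonneg edge_weight_nonneg assms(1))
  \<comment> \<open>A pair carrying weight in \<open>H\<close> serves twice: it gives
    \<open>H\<close> a positive cut, and two distinct vertices, so that connectedness of
    \<open>G\<close> yields an arc.\<close>
  have "energy (edge_weight H) (($) x) \<noteq> 0"
    using assms(5) by (simp add: laplacian_quadratic_form[OF assms(3)])
  then obtain u v where uv: "edge_weight H u v \<noteq> 0" "u \<noteq> v"
    unfolding energy_def by (metis (no_types, lifting) sum.neutral mult_eq_0_iff cancel_comm_monoid_add_class.diff_cancel power_zero_numeral)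
  obtain a b where ab: "(a, b) \<in> edges G"
    using connected_wgraph_arc[OF assms(1,2) uv(2)] .
  have ab_neq: "a \<noteq> b"
  proof -
    interpret pair_graph "underlying G" using assms(1) by (simp add: weighted_graph_def)
    show ?thesis using no_loops[OF ab] by simp
  qed
  have "0 < edge_weight G a b" "0 < edge_weight G b a"
    using ab assms(1) weighted_graph_arc_sym[OF assms(1), of a b]
    by (auto simp: edge_weight_def weighted_graph_def)
  then have vol_pos: "0 < vol G a" "0 < vol G b"
    using edge_weight_le_vol[OF assms(1)] by (meson order_less_le_trans)+
  have V: "0 < V"
    unfolding V_def using vol_nonneg vol_pos(1) by (intro sum_pos2[of _ a]) auto
  have D: "edge_weight ?D u v = (if u = v then 0 else V * (p u * p v))" for u v
    using V by (simp add: edge_weight_demand_graph p_def V_def)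
  have p: "0 \<le> p u" for u using vol_nonneg V by (simp add: p_def)
  have cut_nonneg: "0 \<le> cut W S" if "\<And>u v. 0 \<le> W u v" for W :: "'v \<Rightarrow> 'v \<Rightarrow> real" and S
    unfolding cut_def using that by (simp add: sum_nonneg)
  have D_nonneg: "0 \<le> edge_weight ?D u v" for u v using V p by (simp add: D)
  have cut_pos: "\<exists>S. 0 < cut W S" if "\<And>u v. 0 \<le> W u v" "u \<noteq> v" "W u v \<noteq> 0"
    for W :: "'v \<Rightarrow> 'v \<Rightarrow> real" and u v
  proof -
    have "0 < W u v" using that(1)[of u v] that(3) by simp
    then have "0 < (\<Sum>v\<in>- {u}. W u v)" using that by (intro sum_pos2[of _ v]) auto
    then show ?thesis by (intro exI[of _ "{u}"]) (simp add: cut_def)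
  qed
  obtain S where S: "0 < cut (edge_weight H) S"
    using cut_pos[of "edge_weight H", OF edge_weight_nonneg[OF assms(3)] uv(2,1)] by blast
  \<comment> \<open>The ends of an arc of \<open>G\<close> have positive volume, so the demand graph
    joins them and has a positive cut.\<close>
  have "edge_weight ?D a b \<noteq> 0" using ab_neq vol_pos V by (simp add: D p_def)
  then obtain T where T: "0 < cut (edge_weight ?D) T"
    using cut_pos[of "edge_weight ?D", OF D_nonneg ab_neq] by blast
  note nonneg = cut_nonneg[of "edge_weight G", OF edge_weight_nonneg[OF assms(1)]]
    cut_nonneg[of "edge_weight H", OF edge_weight_nonneg[OF assms(3)]]
    cut_nonneg[of "edge_weight ?D", OF D_nonneg]
  note \<phi> = gen_conductance_bounds[of G ?D T, unfolded cut_weight_eq_cut, OF nonneg(1,3) T]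
  note \<psi> = gen_conductance_bounds[of G H S, unfolded cut_weight_eq_cut, OF nonneg(1,2) S]
  have "gen_conductance G ?D * gen_conductance G H / 4 * energy (edge_weight H) (($) x)
      \<le> energy (edge_weight G) (($) x)"
  proof (rule generalized_cheeger[where p = p])
    show "(\<Sum>v\<in>UNIV. edge_weight G u v) = V * p u" for u
      using V by (simp add: p_def vol_eq_sum_edge_weight)
    show "(\<Sum>u\<in>UNIV. p u) = 1"
      using V by (simp add: p_def V_def flip: sum_divide_distrib)
    have "(\<Sum>u\<in>UNIV. p u * x $ u) = (x \<bullet> degree_vec G) / V"
      by (simp add: p_def inner_vec_def degree_vec_def sum_divide_distrib mult.commute)
    then show "(\<Sum>u\<in>UNIV. p u * x $ u) = 0" using assms(4) by simp
    \<comment> \<open>The two weights differ only on the diagonal, which no cut crosses.\<close>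
    have "cut (\<lambda>u v. V * (p u * p v)) S = cut (edge_weight ?D) S" for S
      unfolding cut_def D by (intro sum.cong) auto
    then show "gen_conductance G ?D * cut (\<lambda>u v. V * (p u * p v)) S \<le> cut (edge_weight G) S" for S
      using \<phi>(2) by simp
  qed (use V \<phi>(1) \<psi> edge_weight_sym[OF assms(1)] edge_weight_nonneg[OF assms(1)]
      edge_weight_nonneg[OF assms(3)] in auto)
  then show ?thesis
    using assms(5) by (simp add: laplacian_quadratic_form assms(1,3) pos_le_divide_eq)
qed

end
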